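(* Let $a\in(0,1/2]$, let $\{\lambda_n\}_{n\ge 0}$ be the positive sequence defined recursively by $\lambda_0=1$ and $$\lambda_n=W_n-\sum_{k=0}^{n-1}\lambda_k b_{n-k},\qquad n\ge 1,$$ where $W_n=\frac{(1/2)_n}{n!}$ and $b_n=\frac{(a)_n(1-a)_n}{(n!)^2}$, and let $$\theta_n=\frac{1}{2n}\sum_{k=0}^n\lambda_k\lambda_{n-k},\qquad n\ge 1.$$ Then for every $r\in(0,1)$, $$\mu_a(r)+\log r=\frac{R(a)}{2}-\sum_{n=1}^{\infty}\theta_n r^{2n}.$$
   Context: $(x)_0=1$ and $(x)_n=x(x+1)\cdots(x+n-1)$ for $n\ge1$ is the Pochhammer symbol. $F(\alpha,\beta;c;x)=\sum_{n=0}^\infty\frac{(\alpha)_n(\beta)_n}{(c)_n}\frac{x^n}{n!}$, $|x|<1$, is the Gaussian hypergeometric function. The generalized Grötzsch ring function is $\mu_a(r)=\frac{\pi}{2\sin(\pi a)}\frac{F(a,1-a;1;1-r^2)}{F(a,1-a;1;r^2)}$ for $r\in(0,1)$. The Ramanujan constant is $R(a)=-2\gamma-\psi(a)-\psi(1-a)$, where $\psi=\Gamma'/\Gamma$ is the digamma function and $\gamma$ is the Euler–Mascheroni constant. *)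

theory Defs
  imports "HOL-Analysis.Analysis"
begin

(* Only meaningful where the series converges: |x| < 1 and c not a nonpositive integer. *)
definition hyp2F1 :: "real \<Rightarrow> real \<Rightarrow> real \<Rightarrow> real \<Rightarrow> real" where
  "hyp2F1 \<alpha> \<beta> c x =
     (\<Sum>n. pochhammer \<alpha> n * pochhammer \<beta> n / pochhammer c n * (x ^ n / fact n))"

definition groetzsch_mu :: "real \<Rightarrow> real \<Rightarrow> real" where
  "groetzsch_mu a r =
     pi / (2 * sin (pi * a)) * (hyp2F1 a (1 - a) 1 (1 - r\<^sup>2) / hyp2F1 a (1 - a) 1 (r\<^sup>2))"

(* Digamma is the logarithmic derivative of Gamma: see has_field_derivative_Gamma. *)
definition ramanujan_R :: "real \<Rightarrow> real" where
  "ramanujan_R a = - 2 * euler_mascheroni - Digamma a - Digamma (1 - a)"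

end

theory Submission
  imports Defs "HOL-Real_Asymp.Real_Asymp"
begin

text \<open>
  Put \<open>x = r\<^sup>2\<close>, \<open>F(x) = F(a, 1 - a; 1; x)\<close> and \<open>m(x) = \<pi> / (2 sin (\<pi> a)) F(1 - x) / F(x)\<close>, so that
  \<open>\<mu>\<^sub>a(r) = m(x)\<close> and \<open>log r = (log x) / 2\<close>.

  The recursion for \<open>\<lambda>\<close> says that \<open>L(x) = \<Sum> \<lambda>\<^sub>n x\<^sup>n\<close> satisfies \<open>L F = (1 - x) powr (- 1 / 2)\<close>. Hence the
  convolution in the definition of \<open>\<theta>\<^sub>n\<close> is the \<open>n\<close>-th coefficient of \<open>L\<^sup>2 = 1 / ((1 - x) F(x)\<^sup>2)\<close>. On the other hand
  \<open>F(x)\<close> and \<open>F(1 - x)\<close> solve the same second-order equation, and their Wronskian shows that \<open>m'(x)\<close> is a multiple of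
  \<open>1 / (x (1 - x) F(x)\<^sup>2) = L(x)\<^sup>2 / x\<close>. Integrating termwise (\<open>mu_log_series\<close>) yields the series up to a constant factor
  and an additive constant.

  Both constants follow from the behaviour at \<open>x = 0\<close>, namely
  \<open>m(x) + (log x) / 2 \<longlonglongrightarrow> R(a) / 2\<close>. This is Gauss's logarithmic asymptotics of a zero-balanced series
  at 1. Its additive constant is the sum of the differences between the normalised coefficients and
  \<open>1 / (n + 1)\<close> (\<open>zb_term_minus_harmonic_sums\<close>). That sum is found by a functional equation: shifting a parameter by 1
  changes it by an explicit telescoping sum, and monotonicity in the parameter excludes any other solution.

  Finally, \<open>\<lambda>\<^sub>n > 0\<close> follows from log-convexity of the coefficients of \<open>F\<close> together with a comparison of
  coefficient ratios (\<open>convolution_quotient_pos\<close>). It implies \<open>\<lambda>\<^sub>n \<le> W\<^sub>n \<le> 1\<close>, which is what makes \<open>L\<close>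
  converge on the whole interval.\<close>

section \<open>The additive constant of a zero-balanced hypergeometric series\<close>

text \<open>
  Up to the factor \<open>\<Gamma>(a) \<Gamma>(b) / \<Gamma>(a + b)\<close> these are the coefficients of
  \<open>F(a, b; a + b; x)\<close>; with this normalisation they are asymptotic to \<open>1 / n\<close>.\<close>

definition zb_term :: "real \<Rightarrow> real \<Rightarrow> nat \<Rightarrow> real" where
  "zb_term a b n = Gamma (n + a) * Gamma (n + b) / (fact n * Gamma (n + a + b))"

lemma Gamma_step: "x > 0 \<Longrightarrow> Gamma (x + 1) = x * Gamma (x::real)"
  by (rule Gamma_plus1) auto

lemma Gamma_real_nonzero: "x > 0 \<Longrightarrow> Gamma (x::real) \<noteq> 0"
  using Gamma_real_pos[of x] by linarith

text \<open>
  By Euler's limit formula each \<open>\<Gamma>(n + x)\<close> behaves like \<open>\<Gamma>(n) n\<^sup>x\<close>, and the powers of \<open>n\<close> cancel.\<close>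

lemma Gamma_quotient_tendsto_1:
  fixes a b :: real
  assumes "a > 0" "b > 0"
  shows "(\<lambda>n. Gamma (n + a) * Gamma (n + b) / (Gamma n * Gamma (n + a + b))) \<longlonglongrightarrow> 1"
proof -
  have "(\<lambda>n. Gamma_series' (a + b) n / (Gamma_series' a n * Gamma_series' b n) *
           (Gamma a * Gamma b / Gamma (a + b)))
          \<longlonglongrightarrow> Gamma (a + b) / (Gamma a * Gamma b) * (Gamma a * Gamma b / Gamma (a + b))"
    using assms by (intro tendsto_intros Gamma_series'_LIMSEQ) (auto simp: Gamma_real_nonzero)
  also have "Gamma (a + b) / (Gamma a * Gamma b) * (Gamma a * Gamma b / Gamma (a + b)) = 1"
    using assms Gamma_real_nonzero[of a] Gamma_real_nonzero[of b] Gamma_real_nonzero[of "a + b"] by simp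
  finally show ?thesis
  proof (rule Lim_transform_eventually)
    show "\<forall>\<^sub>F n in sequentially. Gamma_series' (a + b) n / (Gamma_series' a n * Gamma_series' b n) *
           (Gamma a * Gamma b / Gamma (a + b)) =
           Gamma (n + a) * Gamma (n + b) / (Gamma n * Gamma (n + a + b))"
      using eventually_gt_at_top[of "0::nat"]
    proof eventually_elim
      case (elim n)
      have f: "fact (n - 1) = Gamma (real n)" using elim Gamma_fact[of "n - 1", where 'a = real] by (simp add: of_nat_diff)
      have p: "pochhammer x n = Gamma (n + x) / Gamma x" if "x > 0" for x :: real
        using that pochhammer_Gamma[of x n] by (force simp: add_ac)
      have e: "exp ((a + b) * ln n) = exp (a * ln n) * exp (b * ln n)"
        by (simp add: exp_add[symmetric] algebra_simps)
      have nz: "Gamma (real n) \<noteq> 0" "Gamma (n + a) \<noteq> 0" "Gamma (n + b) \<noteq> 0" "Gamma (n + (a + b)) \<noteq> 0"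
         "Gamma a \<noteq> 0" "Gamma b \<noteq> 0" "Gamma (a + b) \<noteq> 0"
        using elim assms by (auto intro!: Gamma_real_nonzero)
      show ?case
        using assms nz by (simp add: Gamma_series'_def f[simplified] p e add.assoc)
    qed
  qed
qed

text \<open>
  This is Gauss's value of \<open>F(a, b; a + b + 1; 1)\<close> in disguise.
  The \<open>n\<close>-th difference is \<open>b \<Gamma>(n + a) \<Gamma>(n + b) / (n! \<Gamma>(n + a + b + 1))\<close>, which telescopes because
  \<open>(n + a)(n + b) - n (n + a + b) = a b\<close> does not depend on \<open>n\<close>.\<close>

lemma zb_term_shift_sums:
  assumes "a > 0" "b > 0"
  shows "(\<lambda>n. zb_term a b n - zb_term (a + 1) b n) sums (1 / a)"
proof -
  define T where "T n = Gamma (n + a) * Gamma (n + b) / (a * (Gamma n * Gamma (n + a + b)))" for n :: nat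
  have step: "T (Suc n) - T n = zb_term a b n - zb_term (a + 1) b n" for n
  proof -
    have G: "Gamma (1 + (a + n)) = (n + a) * Gamma (n + a)" "Gamma (1 + (b + n)) = (n + b) * Gamma (n + b)"
      "Gamma (1 + (a + (b + n))) = (n + a + b) * Gamma (n + a + b)"
      using assms Gamma_step[of "n + a"] Gamma_step[of "n + b"] Gamma_step[of "n + a + b"]
      by (simp_all add: add_ac)
    have F: "Gamma (1 + real n) = fact n" by (rule Gamma_fact)
    have nz: "Gamma (n + a) \<noteq> 0" "Gamma (n + b) \<noteq> 0" "Gamma (n + a + b) \<noteq> 0" "n + a + b \<noteq> 0"
      using assms by (auto intro!: Gamma_real_nonzero)
    have T0: "T n = n * Gamma (n + a) * Gamma (n + b) / (a * (fact n * Gamma (n + a + b)))"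
    proof (cases "n = 0")
      case False
      then have "Gamma (real n) \<noteq> 0" "fact n = n * Gamma (real n)"
        using F Gamma_step[of n] Gamma_real_nonzero[of n] by (simp_all add: add_ac)
      then show ?thesis using False by (simp add: T_def)
    qed (simp add: T_def)
    have T1: "T (Suc n) = (n + a) * Gamma (n + a) * ((n + b) * Gamma (n + b)) /
        (a * (fact n * ((n + a + b) * Gamma (n + a + b))))"
      using G F by (simp add: T_def add_ac)
    have z1: "zb_term (a + 1) b n = (n + a) * Gamma (n + a) * Gamma (n + b) / (fact n * ((n + a + b) * Gamma (n + a + b)))"
      using G by (simp add: zb_term_def add_ac)
    show ?thesis
      unfolding T0 T1 z1 using nz assms by (simp add: zb_term_def divide_simps) algebra
  qed
  have "(\<lambda>n. (Gamma (n + a) * Gamma (n + b) / (Gamma n * Gamma (n + a + b))) / a) \<longlonglongrightarrow> 1 / a"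
    using assms by (intro tendsto_divide Gamma_quotient_tendsto_1) auto
  then have "T \<longlonglongrightarrow> 1 / a" by (simp add: T_def[abs_def] mult_ac)
  from telescope_sums[OF this] have "(\<lambda>n. T (Suc n) - T n) sums (1 / a - T 0)" .
  moreover have "T 0 = 0" by (simp add: T_def)
  ultimately show ?thesis by (simp only: step diff_zero)
qed

text \<open>
  The logarithmic derivative in \<open>a\<close> is \<open>\<psi>(n + a) - \<psi>(n + a + b)\<close>, and \<open>\<psi>\<close> increases.\<close>

lemma zb_term_antimono:
  assumes "0 < a" "a \<le> a'" "b > 0"
  shows "zb_term a' b n \<le> zb_term a b n"
proof -
  define f where "f x = ln_Gamma (n + x) - ln_Gamma (n + x + b)" for x :: real
  have "f a' \<le> f a"
  proof (rule DERIV_nonpos_imp_nonincreasing[OF assms(2)])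
    fix x assume "a \<le> x" "x \<le> a'"
    then have x: "x > 0" using assms by simp
    have "(f has_real_derivative (Digamma (n + x) - Digamma (n + x + b))) (at x)"
      unfolding f_def using x assms
      by (auto intro!: derivative_eq_intros)
    moreover have "Digamma (n + x) \<le> Digamma (n + x + b)"
      using x assms by (intro Digamma_real_mono) auto
    ultimately show "\<exists>y. (f has_real_derivative y) (at x) \<and> y \<le> 0" by force
  qed
  then have "exp (f a') \<le> exp (f a)" by simp
  moreover have "exp (f x) = Gamma (n + x) / Gamma (n + x + b)" if "x > 0" for x :: real
    using that assms by (simp add: f_def exp_diff Gamma_real_pos_exp)
  ultimately have "Gamma (n + a') / Gamma (n + a' + b) \<le> Gamma (n + a) / Gamma (n + a + b)"
    using assms by simp
  from mult_right_mono[OF this, of "Gamma (n + b) / fact n"] show ?thesis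
    using assms by (simp add: zb_term_def field_simps)
qed

lemma zb_term_1: "b > 0 \<Longrightarrow> zb_term 1 b n = 1 / (n + b)"
  using Gamma_step[of "n + b"] Gamma_fact[of n, where 'a = real] Gamma_real_nonzero[of "n + b"]
  by (simp add: zb_term_def add_ac)

text \<open>
  An argument in the style of Bohr and Mollerup. Replacing \<open>(a, 1)\<close> by \<open>(a + M, 1 + M)\<close> changes the sum
  by the \<open>M\<close>-th partial sum of the series for \<open>-\<psi>(a) - \<gamma>\<close>, by the shift formula. What remains
  is squeezed by monotonicity between \<open>0\<close> and \<open>1 / (a + M)\<close>, because \<open>1 + M \<le> a + M + 1\<close>;
  so it vanishes as \<open>M\<close> grows.\<close>

lemma zb_term_minus_zb_term_1_sums:
  assumes a: "0 < a" "a \<le> 1" and b: "b > 0"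
  shows "(\<lambda>n. zb_term a b n - zb_term 1 b n) sums (- Digamma a - euler_mascheroni)"
proof -
  define f where "f M n = zb_term (a + real M) b n - zb_term (1 + real M) b n" for M n
  define D where "D M = (\<Sum>n. f M n)" for M
  define S where "S M = (\<Sum>k<M. 1 / (a + real k) - 1 / (1 + real k))" for M
  have nonneg: "0 \<le> f M n" for M n using a b unfolding f_def by (simp add: zb_term_antimono)
  have le: "f M n \<le> zb_term (a + real M) b n - zb_term (a + real M + 1) b n" for M n
    using a b zb_term_antimono[of "1 + real M" "a + real M + 1" b n] unfolding f_def by simp
  have sh: "(\<lambda>n. zb_term (x + real M) b n - zb_term (x + real M + 1) b n) sums (1 / (x + real M))" if "x > 0" for x M
    using that b by (intro zb_term_shift_sums) auto
  have summ: "summable (f M)" for M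
    by (rule summable_comparison_test'[OF sums_summable[OF sh[OF a(1), of M]]]) (use nonneg le in \<open>auto simp: abs_of_nonneg\<close>)
  have bounds: "0 \<le> D M" "D M \<le> 1 / (a + real M)" for M
  proof -
    show "0 \<le> D M" unfolding D_def using summ nonneg by (intro suminf_nonneg)
    have "(\<Sum>n. f M n) \<le> (\<Sum>n. zb_term (a + real M) b n - zb_term (a + real M + 1) b n)"
      using le summ sums_summable[OF sh[OF a(1)]] by (intro suminf_le) auto
    then show "D M \<le> 1 / (a + real M)"
      using sums_unique[OF sh[OF a(1), of M]] by (simp add: D_def)
  qed
  have step: "D M = D (Suc M) + (1 / (a + real M) - 1 / (1 + real M))" for M
  proof -
    have "(\<lambda>n. f (Suc M) n + ((zb_term (a + real M) b n - zb_term (a + real M + 1) b n) - (zb_term (1 + real M) b n - zb_term (1 + real M + 1) b n)))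
       sums (D (Suc M) + (1 / (a + real M) - 1 / (1 + real M)))"
      unfolding D_def using a by (intro sums_add sums_diff sh summable_sums summ) auto
    also have "(\<lambda>n. f (Suc M) n + ((zb_term (a + real M) b n - zb_term (a + real M + 1) b n) - (zb_term (1 + real M) b n - zb_term (1 + real M + 1) b n))) = f M"
      by (auto simp: f_def fun_eq_iff add_ac)
    finally show ?thesis by (simp add: D_def sums_iff)
  qed
  have D0: "D 0 = D M + S M" for M
  proof (induction M)
    case (Suc M)
    then show ?case using step[of M] by (simp add: S_def)
  qed (simp add: S_def)
  have "(\<lambda>M. 1 / (a + real M)) \<longlonglongrightarrow> 0"
    by (rule real_tendsto_divide_at_top[OF tendsto_const filterlim_tendsto_add_at_top[OF tendsto_const filterlim_real_sequentially]])
  then have "D \<longlonglongrightarrow> 0"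
    by (rule tendsto_sandwich[OF _ _ tendsto_const, rotated 2]) (use bounds in auto)
  then have "(\<lambda>M. D 0 - D M) \<longlonglongrightarrow> D 0 - 0" by (intro tendsto_intros)
  moreover have "(\<lambda>M. D 0 - D M) = S"
  proof
    show "D 0 - D M = S M" for M using D0[of M] by simp
  qed
  ultimately have "S \<longlonglongrightarrow> D 0" by simp
  moreover have "S \<longlonglongrightarrow> - Digamma a - euler_mascheroni"
  proof -
    have "(\<lambda>k. inverse (of_nat (Suc k)) - inverse (a + of_nat k)) sums (Digamma a + euler_mascheroni)"
      using summable_sums[OF summable_Digamma[of a]] a by (simp add: Digamma_def)
    from sums_minus[OF this] show ?thesis
      by (simp add: sums_def S_def[abs_def] inverse_eq_divide)
  qed
  ultimately have "D 0 = - Digamma a - euler_mascheroni" by (rule LIMSEQ_unique)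
  then show ?thesis using summ[of 0] by (simp add: D_def sums_iff f_def[abs_def])
qed

text \<open>
  At \<open>a = 1\<close> the coefficient is \<open>1 / (n + b)\<close>, whose comparison with \<open>1 / (n + 1)\<close> is the series of \<open>\<psi>(b)\<close>.\<close>

lemma zb_term_minus_harmonic_sums:
  assumes a: "0 < a" "a \<le> 1" and b: "0 < b"
  shows "(\<lambda>n. zb_term a b n - 1 / (real n + 1)) sums (- 2 * euler_mascheroni - Digamma a - Digamma b)"
proof -
  have "(\<lambda>k. inverse (of_nat (Suc k)) - inverse (b + of_nat k)) sums (Digamma b + euler_mascheroni)"
    using summable_sums[OF summable_Digamma[of b]] b by (simp add: Digamma_def)
  note sums_diff[OF zb_term_minus_zb_term_1_sums[OF a b] this]
  moreover have "zb_term a b n - zb_term 1 b n - (inverse (of_nat (Suc n)) - inverse (b + of_nat n)) = zb_term a b n - 1 / (real n + 1)" for n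
    using b by (simp add: zb_term_1 inverse_eq_divide add_ac)
  moreover have "- Digamma a - euler_mascheroni - (Digamma b + euler_mascheroni) = - 2 * euler_mascheroni - Digamma a - Digamma b"
    by simp
  ultimately show ?thesis by (simp only:)
qed

section \<open>The hypergeometric series F(a, 1 - a; 1; x)\<close>

text \<open>
  For nonnegative terms Abel's limit theorem is immediate: the terms \<open>f n\<close> themselves dominate on \<open>[0, 1]\<close>,
  so the convergence is uniform there.\<close>

lemma Abel_limit_nonneg:
  fixes f :: "nat \<Rightarrow> real"
  assumes "f sums s" "\<And>n. f n \<ge> 0"
  shows "((\<lambda>x. \<Sum>n. f n * x ^ n) \<longlongrightarrow> s) (at_left 1)"
proof -
  have "uniform_limit {0..1} (\<lambda>N x. \<Sum>n<N. f n * x ^ n) (\<lambda>x. \<Sum>n. f n * x ^ n) sequentially"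
    using assms by (intro Weierstrass_m_test[where M = f])
      (auto simp: sums_iff abs_mult power_le_one intro!: mult_left_le)
  then have "continuous_on {0..1} (\<lambda>x. \<Sum>n. f n * x ^ n)"
    by (rule uniform_limit_theorem[rotated]) (auto intro!: always_eventually continuous_intros)
  then have "((\<lambda>x. \<Sum>n. f n * x ^ n) \<longlongrightarrow> (\<Sum>n. f n * 1 ^ n)) (at 1 within {0..1})"
    unfolding continuous_on_def by (rule bspec) auto
  moreover have "at 1 within {0..1} = at_left (1::real)"
    by (rule at_within_Icc_at_left) simp
  ultimately show ?thesis using assms by (simp add: sums_iff)
qed

definition hcoef :: "real \<Rightarrow> nat \<Rightarrow> real" where
  "hcoef a n = pochhammer a n * pochhammer (1 - a) n / (fact n)\<^sup>2"

definition hypF :: "real \<Rightarrow> real \<Rightarrow> real" where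
  "hypF a x = (\<Sum>n. hcoef a n * x ^ n)"

lemma hyp2F1_eq_hypF: "hyp2F1 a (1 - a) 1 x = hypF a x"
  unfolding hyp2F1_def hypF_def hcoef_def
  by (simp add: pochhammer_fact[symmetric] power2_eq_square field_simps)

lemma hcoef_0 [simp]: "hcoef a 0 = 1"
  by (simp add: hcoef_def)

lemma hcoef_Suc: "(real n + 1)\<^sup>2 * hcoef a (Suc n) = (n + a) * (n + 1 - a) * hcoef a n"
proof -
  have "(x + 1)\<^sup>2 * (p * (a + x) * (q * (1 - a + x)) / ((x + 1) * f)\<^sup>2) = (x + a) * (x + 1 - a) * (p * q / f\<^sup>2)"
    if "x + 1 \<noteq> 0" for x p q f :: real
    using that by (simp add: power_mult_distrib mult_ac add_ac)
  from this[of n "pochhammer a n" "pochhammer (1 - a) n" "fact n"] show ?thesis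
    by (simp add: hcoef_def pochhammer_Suc add_ac)
qed

lemma pochhammer_le_fact:
  fixes a :: real
  assumes "0 < a" "a \<le> 1" shows "pochhammer a n \<le> fact n"
proof (induction n)
  case (Suc n)
  have "pochhammer a n * (a + n) \<le> fact n * (1 + real n)"
    using assms Suc by (intro mult_mono) (auto intro!: pochhammer_nonneg)
  then show ?case by (simp add: pochhammer_Suc algebra_simps)
qed simp

lemma hcoef_pos: "0 < a \<Longrightarrow> a < 1 \<Longrightarrow> 0 < hcoef a n"
  by (simp add: hcoef_def pochhammer_pos)

lemma hcoef_le_1:
  assumes "0 < a" "a < 1" shows "hcoef a n \<le> 1"
proof -
  have "pochhammer a n * pochhammer (1 - a) n \<le> fact n * fact n"
    using assms by (intro mult_mono pochhammer_le_fact) (auto intro!: pochhammer_nonneg)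
  then show ?thesis by (simp add: hcoef_def power2_eq_square)
qed

lemma summable_bounded_powser:
  fixes c :: "nat \<Rightarrow> real"
  assumes "\<And>n. \<bar>c n\<bar> \<le> B" "\<bar>x\<bar> < 1"
  shows "summable (\<lambda>n. norm (c n * x ^ n))"
proof (rule summable_comparison_test')
  show "summable (\<lambda>n. B * \<bar>x\<bar> ^ n)" using assms by (intro summable_mult summable_geometric) auto
  show "norm (norm (c n * x ^ n)) \<le> B * \<bar>x\<bar> ^ n" for n
    using assms by (auto simp: abs_mult power_abs intro!: mult_right_mono)
qed

lemma summable_hcoef:
  assumes "0 < a" "a < 1" "\<bar>x\<bar> < 1"
  shows "summable (\<lambda>n. norm (hcoef a n * x ^ n))" "summable (\<lambda>n. hcoef a n * x ^ n)"
proof -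
  show "summable (\<lambda>n. norm (hcoef a n * x ^ n))"
    using assms hcoef_pos[of a] hcoef_le_1[of a]
    by (intro summable_bounded_powser[where B = 1]) (auto simp: abs_of_pos)
  then show "summable (\<lambda>n. hcoef a n * x ^ n)" by (rule summable_norm_cancel)
qed

lemma hypF_pos:
  assumes "0 < a" "a < 1" "0 \<le> x" "x < 1"
  shows "hypF a x > 0"
proof -
  have "0 < hcoef a 0 * x ^ 0" by simp
  also have "hcoef a 0 * x ^ 0 = (\<Sum>n\<in>{0}. hcoef a n * x ^ n)" by simp
  also have "\<dots> \<le> hypF a x"
    unfolding hypF_def using assms summable_hcoef(2)[of a x] hcoef_pos[of a]
    by (intro sum_le_suminf) (auto simp: less_imp_le)
  finally show ?thesis .
qed

lemma hypF_0 [simp]: "hypF a 0 = 1"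
  by (simp add: hypF_def)

lemma hypF_deriv:
  assumes "0 < a" "a < 1" "\<bar>x\<bar> < 1"
  shows "(hypF a has_real_derivative (\<Sum>n. diffs (hcoef a) n * x ^ n)) (at x)"
  unfolding hypF_def[abs_def] using assms summable_hcoef(2)
  by (intro termdiffs_strong'[where K = 1]) auto

text \<open>
  The hypergeometric equation in self-adjoint form reads \<open>(x (1 - x) F'(x))' = a (1 - a) F(x)\<close>, so this
  weighted derivative is the second component of the equivalent first-order system.\<close>

definition weighted_deriv :: "real \<Rightarrow> real \<Rightarrow> real" where
  "weighted_deriv a x = x * (1 - x) * deriv (hypF a) x"

text \<open>
  Coefficientwise: the product \<open>x (1 - x) F'(x)\<close> has coefficients \<open>n h(n) - (n - 1) h(n - 1)\<close>, and after one more
  differentiation the recurrence of the hypergeometric coefficients applies.\<close>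

lemma weighted_deriv_has_derivative:
  assumes a: "0 < a" "a < 1" and x: "\<bar>x\<bar> < 1"
  shows "(weighted_deriv a has_real_derivative (a * (1 - a) * hypF a x)) (at x)"
proof -
  define q where "q n = n * hcoef a n - real (n - 1) * hcoef a (n - 1)" for n
  have dq: "diffs q n = a * (1 - a) * hcoef a n" for n
    using hcoef_Suc[of n a] by (simp add: diffs_def q_def power2_eq_square algebra_simps)
  have series: "(\<lambda>n. q n * y ^ n) sums weighted_deriv a y" if y: "\<bar>y\<bar> < 1" for y
  proof -
    have "summable (\<lambda>n. diffs (hcoef a) n * y ^ n)"
      using a y summable_hcoef(2) by (intro termdiff_converges[of y 1]) auto
    then have "(\<lambda>n. diffs (hcoef a) n * y ^ n) sums deriv (hypF a) y"
      using DERIV_imp_deriv[OF hypF_deriv[OF a y]] by (simp add: sums_iff)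
    from sums_mult[OF this, of y]
    have "(\<lambda>n. real (Suc n) * hcoef a (Suc n) * y ^ Suc n) sums (y * deriv (hypF a) y)"
      by (simp add: diffs_def mult_ac)
    then have E: "(\<lambda>n. real n * hcoef a n * y ^ n) sums (y * deriv (hypF a) y)"
      by (subst (asm) sums_Suc_iff) simp
    from sums_mult[OF E, of y]
    have "(\<lambda>n. real (Suc n - 1) * hcoef a (Suc n - 1) * y ^ Suc n) sums (y * (y * deriv (hypF a) y))"
      by (simp add: mult_ac)
    then have "(\<lambda>n. real (n - 1) * hcoef a (n - 1) * y ^ n) sums (y * (y * deriv (hypF a) y))"
      by (subst (asm) sums_Suc_iff) simp
    from sums_diff[OF E this] show ?thesis
      by (simp add: q_def weighted_deriv_def algebra_simps)
  qed
  have "((\<lambda>y. \<Sum>n. q n * y ^ n) has_real_derivative (\<Sum>n. diffs q n * x ^ n)) (at x)"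
    using series x by (intro termdiffs_strong'[where K = 1]) (auto simp: sums_iff)
  also have "(\<Sum>n. diffs q n * x ^ n) = a * (1 - a) * hypF a x"
    using suminf_mult[OF summable_hcoef(2)[OF a x], of "a * (1 - a)"]
    by (simp add: dq hypF_def mult_ac)
  finally show ?thesis
    by (rule has_field_derivative_transform_within_open[where S = "{-1<..<1}"])
      (use series x in \<open>auto simp: sums_iff\<close>)
qed

section \<open>Behaviour at the logarithmic singularity\<close>

lemma Gamma_reflection_real:
  fixes a :: real
  assumes "0 < a" "a < 1"
  shows "Gamma a * Gamma (1 - a) = pi / sin (pi * a)"
proof -
  have "complex_of_real (Gamma a * Gamma (1 - a)) = Gamma (of_real a) * Gamma (1 - of_real a)"
    by (simp add: Gamma_complex_of_real[symmetric])
  also have "\<dots> = of_real (pi / sin (pi * a))"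
    by (subst Gamma_reflection_complex) (simp flip: sin_of_real of_real_mult)
  finally show ?thesis by (simp only: of_real_eq_iff)
qed

lemma sin_pi_mult_pos: "0 < a \<Longrightarrow> a < 1 \<Longrightarrow> 0 < sin (pi * a)"
  by (rule sin_gt_zero) auto

lemma zb_term_eq_hcoef:
  assumes a: "0 < a" "a < 1"
  shows "zb_term a (1 - a) n = pi / sin (pi * a) * hcoef a n"
proof -
  have p: "pochhammer x n = Gamma (n + x) / Gamma x" if "x > 0" for x :: real
    using that pochhammer_Gamma[of x n] by (force simp: add_ac)
  have "Gamma (real n + a + (1 - a)) = fact n"
    using Gamma_fact[of n, where 'a = real] by (simp add: add_ac)
  moreover have "Gamma a \<noteq> 0" "Gamma (1 - a) \<noteq> 0"
    using a by (auto intro!: Gamma_real_nonzero)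
  ultimately show ?thesis
    using a unfolding zb_term_def hcoef_def Gamma_reflection_real[OF a, symmetric]
    by (simp add: p power2_eq_square)
qed

lemma log_series:
  assumes "0 < x" "x < 1"
  shows "(\<lambda>n. 1 / (real n + 1) * (1 - x) ^ n) sums (- ln x / (1 - x))"
proof -
  have summ: "summable (\<lambda>n. 1 / (real n + 1) * (1 - x) ^ n)"
    by (rule summable_norm_cancel, rule summable_bounded_powser[where B = 1]) (use assms in auto)
  have "ln x = (\<Sum>n. (- 1) ^ n * (1 / real (n + 1)) * (x - 1) ^ Suc n)"
    using assms by (intro ln_series) auto
  also have "(\<lambda>n. (- 1) ^ n * (1 / real (n + 1)) * (x - 1) ^ Suc n) =
     (\<lambda>n. - (1 - x) * (1 / (real n + 1) * (1 - x) ^ n))"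
  proof
    fix n
    have e: "(- 1) ^ n * (x - 1) ^ n = (1 - x) ^ n" by (simp flip: power_mult_distrib)
    have "(- 1) ^ n * (1 / real (n + 1)) * (x - 1) ^ Suc n =
        (- 1) ^ n * (x - 1) ^ n * (1 / (real n + 1) * (x - 1))"
      by (simp add: mult_ac add_ac)
    then show "(- 1) ^ n * (1 / real (n + 1)) * (x - 1) ^ Suc n = - (1 - x) * (1 / (real n + 1) * (1 - x) ^ n)"
      unfolding e by (simp add: mult_ac)
  qed
  also have "(\<Sum>n. - (1 - x) * (1 / (real n + 1) * (1 - x) ^ n)) = - (1 - x) * (\<Sum>n. 1 / (real n + 1) * (1 - x) ^ n)"
    by (rule suminf_mult[OF summ])
  finally have ln: "ln x = - (1 - x) * (\<Sum>n. 1 / (real n + 1) * (1 - x) ^ n)" .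
  have "- (- (1 - x) * S) / (1 - x) = S" for S
    using assms by (simp only: mult_minus_left minus_minus) simp
  from this[of "\<Sum>n. 1 / (real n + 1) * (1 - x) ^ n"] have "- ln x / (1 - x) = (\<Sum>n. 1 / (real n + 1) * (1 - x) ^ n)"
    unfolding ln .
  then show ?thesis using summ by (simp only: summable_sums)
qed

lemma zb_term_ge_harmonic:
  assumes "0 < a" "a \<le> 1" "0 < b" "b \<le> 1"
  shows "1 / (real n + 1) \<le> zb_term a b n"
proof -
  have "1 / (real n + 1) \<le> zb_term 1 b n" using assms by (simp add: zb_term_1 frac_le)
  also have "\<dots> \<le> zb_term a b n" using assms by (intro zb_term_antimono) auto
  finally show ?thesis .
qed

text \<open>
  Subtracting the series of the logarithm from that of \<open>\<pi> / sin (\<pi> a) F\<close> leaves nonnegative coefficients whose sum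
  is \<open>R(a)\<close>, and Abel's theorem gives the limit.\<close>

lemma hypF_asymptotics_at_1:
  assumes a: "0 < a" "a < 1"
  shows "((\<lambda>x. pi / sin (pi * a) * hypF a (1 - x) + ln x / (1 - x)) \<longlongrightarrow> ramanujan_R a) (at_right 0)"
proof -
  let ?f = "\<lambda>n. zb_term a (1 - a) n - 1 / (real n + 1)"
  have "((\<lambda>y. \<Sum>n. ?f n * y ^ n) \<longlongrightarrow> ramanujan_R a) (at_left 1)"
    unfolding ramanujan_R_def
    using a by (intro Abel_limit_nonneg zb_term_minus_harmonic_sums) (auto intro!: zb_term_ge_harmonic)
  moreover have "filterlim (\<lambda>x. 1 - x) (at_left 1) (at_right (0::real))"
    unfolding filterlim_at
    by (auto simp: eventually_at_filter intro!: tendsto_eq_intros)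
  ultimately have "((\<lambda>x. \<Sum>n. ?f n * (1 - x) ^ n) \<longlongrightarrow> ramanujan_R a) (at_right 0)"
    by (rule filterlim_compose)
  moreover have "\<forall>\<^sub>F x in at_right 0. x \<in> {0<..<1::real}"
    by (rule eventually_at_right_real) simp
  then have "\<forall>\<^sub>F x in at_right 0. (\<Sum>n. ?f n * (1 - x) ^ n) = pi / sin (pi * a) * hypF a (1 - x) + ln x / (1 - x)"
  proof eventually_elim
    case (elim x)
    have "(\<lambda>n. hcoef a n * (1 - x) ^ n) sums hypF a (1 - x)"
      unfolding hypF_def using elim a by (intro summable_sums summable_hcoef) auto
    from sums_diff[OF sums_mult[OF this, of "pi / sin (pi * a)"] log_series[of x]]
    have "(\<lambda>n. ?f n * (1 - x) ^ n) sums (pi / sin (pi * a) * hypF a (1 - x) - (- ln x / (1 - x)))"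
      using elim a by (simp add: zb_term_eq_hcoef left_diff_distrib mult.assoc)
    then show ?case by (simp add: sums_iff)
  qed
  ultimately show ?thesis by (rule Lim_transform_eventually)
qed

text \<open>
  The equation is invariant under \<open>x \<mapsto> 1 - x\<close>, so this is the Wronskian of the solutions \<open>F(x)\<close> and \<open>F(1 - x)\<close>
  times \<open>x (1 - x)\<close>, up to sign. Its value \<open>sin (\<pi> a) / \<pi>\<close> emerges in the proof of the expansion below.\<close>

lemma hypF_wronskian_const:
  assumes a: "0 < a" "a < 1"
  obtains K where "\<And>x. 0 < x \<Longrightarrow> x < 1 \<Longrightarrow> weighted_deriv a x * hypF a (1 - x) + hypF a x * weighted_deriv a (1 - x) = K"
proof -
  define V where "V x = weighted_deriv a x * hypF a (1 - x) + hypF a x * weighted_deriv a (1 - x)" for x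
  have "(V has_real_derivative 0) (at x)" if x: "x \<in> {0<..<1}" for x
  proof -
    have d: "(hypF a has_real_derivative deriv (hypF a) y) (at y)" if "\<bar>y\<bar> < 1" for y
      using hypF_deriv[OF a that] DERIV_imp_deriv by metis
    have r: "(g has_real_derivative D) (at (1 - x)) \<Longrightarrow> ((\<lambda>x. g (1 - x)) has_real_derivative - D) (at x)" for g D
      using DERIV_chain2[of g D "\<lambda>x. 1 - x" x "- 1" UNIV] DERIV_diff[OF DERIV_const DERIV_ident, of 1 x UNIV] by simp
    have "(V has_real_derivative
       (a * (1 - a) * hypF a x * hypF a (1 - x) + - deriv (hypF a) (1 - x) * weighted_deriv a x) +
       (deriv (hypF a) x * weighted_deriv a (1 - x) + - (a * (1 - a) * hypF a (1 - x)) * hypF a x)) (at x)"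
      unfolding V_def[abs_def] using x
      by (intro DERIV_add DERIV_mult d r weighted_deriv_has_derivative a) auto
    then show ?thesis by (simp add: weighted_deriv_def algebra_simps)
  qed
  then have "\<exists>c. \<forall>x\<in>{0<..<1}. V x = c"
    by (intro has_field_derivative_zero_constant) (auto simp: has_field_derivative_at_within)
  then show ?thesis using that unfolding V_def by auto
qed

section \<open>Positivity of the coefficients of a quotient of power series\<close>

text \<open>
  A relative of Kaluza's theorem for \<open>lam = W / b\<close> as power series. Multiply the convolution identity at \<open>m + 1\<close> by
  \<open>b m\<close>. Log-convexity turns each product \<open>b (m + 1 - k) * b m\<close> into at most \<open>b (m - k) * b (m + 1)\<close>, so by
  induction the terms with \<open>k \<le> m\<close> add up to at most \<open>W m * b (m + 1)\<close>, which is less than \<open>W (m + 1) * b m\<close>.\<close>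

lemma convolution_quotient_pos:
  fixes b W lam :: "nat \<Rightarrow> real"
  assumes b0: "b 0 = 1" and bpos: "\<And>n. 0 < b n" and W0: "0 < W 0"
    and log_convex: "\<And>m n. m \<le> n \<Longrightarrow> b (Suc m) * b n \<le> b (Suc n) * b m"
    and ratio: "\<And>n. b (Suc n) * W n < W (Suc n) * b n"
    and conv: "\<And>n. (\<Sum>k\<le>n. lam k * b (n - k)) = W n"
  shows "0 < lam n"
proof (induction n rule: less_induct)
  case (less n)
  show ?case
  proof (cases n)
    case 0
    then show ?thesis using conv[of 0] b0 W0 by simp
  next
    case (Suc m)
    have "(\<Sum>k\<le>m. lam k * b (Suc m - k) * b m) \<le> (\<Sum>k\<le>m. lam k * b (m - k) * b (Suc m))"
    proof (rule sum_mono)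
      fix k assume k: "k \<in> {..m}"
      have "lam k * (b (Suc (m - k)) * b m) \<le> lam k * (b (Suc m) * b (m - k))"
        using k Suc less[of k] by (intro mult_left_mono log_convex) auto
      then show "lam k * b (Suc m - k) * b m \<le> lam k * b (m - k) * b (Suc m)"
        using k by (simp add: Suc_diff_le mult_ac)
    qed
    also have "\<dots> = W m * b (Suc m)" by (simp add: conv flip: sum_distrib_right)
    also have "\<dots> < W (Suc m) * b m" using ratio[of m] by (simp add: mult_ac)
    also have "\<dots> = (\<Sum>k\<le>m. lam k * b (Suc m - k) * b m) + lam (Suc m) * b m"
      using conv[of "Suc m"] b0 by (simp add: distrib_right sum_distrib_right flip: conv)
    finally show ?thesis using bpos[of m] Suc by (simp add: zero_less_mult_iff)
  qed
qed

text \<open>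
  The ratio of consecutive coefficients is \<open>1 - 1 / t + a (1 - a) / t\<^sup>2\<close> with \<open>t = n + 1\<close>. It increases for
  \<open>t \<ge> 1\<close> because \<open>a (1 - a) \<le> 1 / 4\<close>.\<close>

lemma hcoef_log_convex:
  assumes a: "0 < a" "a < 1" and mn: "m \<le> n"
  shows "hcoef a (Suc m) * hcoef a n \<le> hcoef a (Suc n) * hcoef a m"
proof -
  define \<rho> where "\<rho> n = (n + a) * (n + 1 - a) / (real n + 1)\<^sup>2" for n :: nat
  have ratio: "hcoef a (Suc n) = \<rho> n * hcoef a n" for n
    using hcoef_Suc[of n a] by (simp add: \<rho>_def field_simps)
  have "incseq \<rho>"
  proof (rule incseq_SucI)
    fix n
    define t where "t = real n + 1"
    have t: "t \<ge> 1" by (simp add: t_def)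
    have "a * (1 - a) \<le> 1 / 4"
      using zero_le_power2[of "a - 1 / 2"] by (simp add: power2_eq_square algebra_simps)
    from mult_right_mono[OF this, of "2 * t + 1"] t mult_mono[of 1 t 1 t]
    have "a * (1 - a) * (2 * t + 1) \<le> t * t + t" by (simp add: algebra_simps)
    then have "(t - 1 + a) * (t - a) * (t + 1)\<^sup>2 \<le> (t + a) * (t + 1 - a) * t\<^sup>2"
      by (simp add: power2_eq_square algebra_simps)
    then have "(t - 1 + a) * (t - a) / t\<^sup>2 \<le> (t + a) * (t + 1 - a) / (t + 1)\<^sup>2"
      using t by (simp add: divide_le_eq pos_le_divide_eq mult_ac)
    then show "\<rho> n \<le> \<rho> (Suc n)" by (simp add: \<rho>_def t_def add_ac)
  qed
  then have "\<rho> m \<le> \<rho> n" using mn by (rule incseqD)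
  from mult_right_mono[OF this, of "hcoef a m * hcoef a n"] show ?thesis
    using hcoef_pos[OF a, of m] hcoef_pos[OF a, of n] by (simp add: ratio mult_ac)
qed

section \<open>The expansion of the Groetzsch function\<close>

text \<open>
  Here \<open>x = r\<^sup>2\<close>. The asymptotics of \<open>F(1 - x)\<close> carry the singular term \<open>ln x / ((1 - x) F(x))\<close> instead of \<open>ln x\<close>;
  the discrepancy tends to 0 since \<open>(1 - x) F(x) = 1 + O(x)\<close> and \<open>x ln x\<close> tends to 0.\<close>

lemma mu_log_tendsto:
  assumes a: "0 < a" "a < 1"
  shows "((\<lambda>x. pi / (2 * sin (pi * a)) * (hypF a (1 - x) / hypF a x) + ln x / 2) \<longlongrightarrow> ramanujan_R a / 2) (at_right 0)"
proof -
  define \<phi> where "\<phi> x = (1 - x) * hypF a x" for x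
  have "(\<phi> has_real_derivative ((1 - 0) * deriv (hypF a) 0 - hypF a 0)) (at 0)"
    unfolding \<phi>_def[abs_def]
    using DERIV_imp_deriv[OF hypF_deriv[of a 0]] hypF_deriv[of a 0] a
    by (auto intro!: derivative_eq_intros)
  then have quot: "((\<lambda>x. (\<phi> x - 1) / x) \<longlongrightarrow> deriv (hypF a) 0 - 1) (at_right 0)"
    unfolding has_field_derivative_iff by (auto simp: \<phi>_def intro: filterlim_mono at_le)
  have F0: "(hypF a \<longlongrightarrow> hypF a 0) (at_right 0)"
    using DERIV_isCont[OF hypF_deriv[of a 0]] a
    by (auto simp: isCont_def intro: filterlim_mono at_le)
  then have \<phi>0: "(\<phi> \<longlongrightarrow> 1) (at_right 0)"
    unfolding \<phi>_def[abs_def] by (auto intro!: tendsto_eq_intros)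
  have xlnx: "((\<lambda>x::real. x * ln x) \<longlongrightarrow> 0) (at_right 0)" by real_asymp
  have "((\<lambda>x. (pi / sin (pi * a) * hypF a (1 - x) + ln x / (1 - x)) / (2 * hypF a x) +
          (x * ln x) * ((\<phi> x - 1) / x) / (2 * \<phi> x)) \<longlongrightarrow>
        ramanujan_R a / (2 * hypF a 0) + 0 * (deriv (hypF a) 0 - 1) / (2 * 1)) (at_right 0)"
    by (intro tendsto_intros hypF_asymptotics_at_1 a F0 \<phi>0 xlnx quot) auto
  then have "((\<lambda>x. (pi / sin (pi * a) * hypF a (1 - x) + ln x / (1 - x)) / (2 * hypF a x) +
          (x * ln x) * ((\<phi> x - 1) / x) / (2 * \<phi> x)) \<longlongrightarrow> ramanujan_R a / 2) (at_right 0)"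
    by simp
  moreover have "\<forall>\<^sub>F x in at_right 0. x \<in> {0<..<1::real}"
    by (rule eventually_at_right_real) simp
  then have "\<forall>\<^sub>F x in at_right 0. (pi / sin (pi * a) * hypF a (1 - x) + ln x / (1 - x)) / (2 * hypF a x) +
          (x * ln x) * ((\<phi> x - 1) / x) / (2 * \<phi> x) =
          pi / (2 * sin (pi * a)) * (hypF a (1 - x) / hypF a x) + ln x / 2"
  proof eventually_elim
    case (elim x)
    have "hypF a x \<noteq> 0" "x \<noteq> 0" "1 - x \<noteq> 0" "sin (pi * a) \<noteq> 0"
      using elim hypF_pos[OF a, of x] sin_pi_mult_pos[OF a] by auto
    then show ?case by (simp add: \<phi>_def divide_simps) algebra
  qed
  ultimately show ?thesis by (rule Lim_transform_eventually)
qed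

text \<open>
  By the Wronskian, the derivative of the quotient \<open>m\<close> is a constant multiple of \<open>1 / (x (1 - x) F(x)\<^sup>2)\<close>, and
  the hypothesis expands \<open>1 / ((1 - x) F(x)\<^sup>2)\<close> in powers of \<open>x\<close>. Termwise integration therefore gives \<open>m\<close> up to
  a factor \<open>\<kappa>\<close> and an additive constant. Both are read off from the limit of \<open>m x + ln x / 2\<close> at 0.\<close>

lemma mu_log_series:
  fixes p :: "nat \<Rightarrow> real"
  assumes a: "0 < a" "a < 1" and p0: "p 0 = 1"
    and p: "\<And>x. 0 < x \<Longrightarrow> x < 1 \<Longrightarrow> (\<lambda>n. p n * x ^ n) sums (1 / ((1 - x) * (hypF a x)\<^sup>2))"
    and x: "0 < x" "x < 1"
  shows "(\<lambda>n. p (Suc n) / (2 * real (Suc n)) * x ^ Suc n) sums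
    (ramanujan_R a / 2 - (pi / (2 * sin (pi * a)) * (hypF a (1 - x) / hypF a x) + ln x / 2))"
proof -
  define m where "m x = pi / (2 * sin (pi * a)) * (hypF a (1 - x) / hypF a x)" for x
  \<comment> \<open>The value at 0 is 0 because division by 0 gives 0.\<close>
  define c where "c n = p n / (2 * real n)" for n
  define T where "T x = (\<Sum>n. c n * x ^ n)" for x
  obtain K where K: "\<And>x. 0 < x \<Longrightarrow> x < 1 \<Longrightarrow> weighted_deriv a x * hypF a (1 - x) + hypF a x * weighted_deriv a (1 - x) = K"
    using hypF_wronskian_const[OF a] by blast
  define \<kappa> where "\<kappa> = pi * K / sin (pi * a)"
  have summ: "summable (\<lambda>n. c n * y ^ n)" if y: "\<bar>y\<bar> < 1" for y
  proof -
    obtain z where z: "\<bar>y\<bar> < z" "z < 1" using dense[OF y] by blast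
    then have "summable (\<lambda>n. p n * z ^ n)" using p[of z] by (simp add: sums_iff)
    then have s: "summable (\<lambda>n. norm (p n * y ^ n))" using z by (intro powser_insidea) auto
    have "norm (c n * y ^ n) \<le> norm (p n * y ^ n)" for n
    proof (cases "n = 0")
      case False
      then have "norm (p n * y ^ n) / (2 * real n) \<le> norm (p n * y ^ n) / 1"
        by (intro divide_left_mono) auto
      then show ?thesis by (simp add: c_def abs_mult)
    qed (simp add: c_def)
    then show ?thesis by (intro summable_comparison_test'[OF s]) auto
  qed
  have dT: "(T has_real_derivative (\<Sum>n. diffs c n * y ^ n)) (at y)" if "\<bar>y\<bar> < 1" for y
    unfolding T_def[abs_def] using that summ by (intro termdiffs_strong'[where K = 1]) auto
  have T': "(\<Sum>n. diffs c n * y ^ n) = (1 / ((1 - y) * (hypF a y)\<^sup>2) - 1) / (2 * y)" if y: "0 < y" "y < 1" for y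
  proof -
    have "summable (\<lambda>n. diffs c n * y ^ n)"
      using y summ by (intro termdiff_converges[of y 1]) auto
    from sums_mult[OF summable_sums[OF this], of "2 * y"]
    have "(\<lambda>n. p (Suc n) * y ^ Suc n) sums (2 * y * (\<Sum>n. diffs c n * y ^ n))"
      by (simp add: diffs_def c_def mult_ac del: of_nat_Suc)
    then have "(\<lambda>n. p n * y ^ n) sums (2 * y * (\<Sum>n. diffs c n * y ^ n) + 1)"
      by (subst (asm) sums_Suc_iff) (simp add: p0)
    then have "2 * y * (\<Sum>n. diffs c n * y ^ n) + 1 = 1 / ((1 - y) * (hypF a y)\<^sup>2)"
      using p[OF y] sums_unique2 by blast
    then show ?thesis using y by (simp add: field_simps)
  qed
  have "((\<lambda>y. m y + \<kappa> * (ln y / 2 + T y)) has_real_derivative 0) (at y)" if y: "0 < y" "y < 1" for y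
  proof -
    have d: "(hypF a has_real_derivative deriv (hypF a) y) (at y)" if "\<bar>y\<bar> < 1" for y
      using hypF_deriv[OF a that] DERIV_imp_deriv by metis
    have d': "((\<lambda>y. hypF a (1 - y)) has_real_derivative - deriv (hypF a) (1 - y)) (at y)"
      using DERIV_chain2[OF d[of "1 - y"] DERIV_diff[OF DERIV_const DERIV_ident, of 1 y UNIV]] y by simp
    have nz: "hypF a y \<noteq> 0" "y \<noteq> 0" "1 - y \<noteq> 0" "sin (pi * a) \<noteq> 0"
      using y hypF_pos[OF a, of y] sin_pi_mult_pos[OF a] by auto
    have "((\<lambda>y. m y + \<kappa> * (ln y / 2 + T y)) has_real_derivative
      pi / (2 * sin (pi * a)) * ((- deriv (hypF a) (1 - y) * hypF a y - hypF a (1 - y) * deriv (hypF a) y) / (hypF a y * hypF a y))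
       + \<kappa> * (1 / y / 2 + (1 / ((1 - y) * (hypF a y)\<^sup>2) - 1) / (2 * y))) (at y)"
      unfolding m_def
    proof (rule DERIV_add[OF DERIV_cmult[OF DERIV_divide[OF d' d nz(1)]] DERIV_cmult[OF DERIV_add[OF DERIV_cdivide]]])
      show "\<bar>y\<bar> < 1" using y by simp
      show "(ln has_real_derivative 1 / y) (at y)" using y by (intro DERIV_ln_divide)
      show "(T has_real_derivative (1 / ((1 - y) * (hypF a y)\<^sup>2) - 1) / (2 * y)) (at y)"
        using dT[of y] T'[OF y] y by simp
    qed
    also have "pi / (2 * sin (pi * a)) * ((- deriv (hypF a) (1 - y) * hypF a y - hypF a (1 - y) * deriv (hypF a) y) / (hypF a y * hypF a y))
       + \<kappa> * (1 / y / 2 + (1 / ((1 - y) * (hypF a y)\<^sup>2) - 1) / (2 * y)) = 0"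
    proof -
      have "- deriv (hypF a) (1 - y) * hypF a y - hypF a (1 - y) * deriv (hypF a) y = - K / (y * (1 - y))"
        unfolding K[OF y, symmetric] weighted_deriv_def using nz by (simp add: field_simps)
      moreover have "1 / y / 2 + (X - 1) / (2 * y) = X / (2 * y)" for X
        using nz by (simp add: field_simps)
      ultimately show ?thesis by (simp add: \<kappa>_def power2_eq_square mult_ac)
    qed
    finally show ?thesis .
  qed
  then have "\<exists>C. \<forall>y\<in>{0<..<1}. m y + \<kappa> * (ln y / 2 + T y) = C"
    by (intro has_field_derivative_zero_constant) (auto simp: has_field_derivative_at_within)
  then obtain C where C: "\<And>y. 0 < y \<Longrightarrow> y < 1 \<Longrightarrow> m y + \<kappa> * (ln y / 2 + T y) = C"
    by auto
  have "(T \<longlongrightarrow> T 0) (at_right 0)"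
    using DERIV_isCont[OF dT[of 0]] by (auto simp: isCont_def intro: filterlim_mono at_le)
  moreover have "T 0 = c 0" unfolding T_def by (rule powser_zero)
  ultimately have T0: "(T \<longlongrightarrow> 0) (at_right 0)" by (simp add: c_def)
  have "((\<lambda>y. (m y + ln y / 2) - C + \<kappa> * T y) \<longlongrightarrow> ramanujan_R a / 2 - C + \<kappa> * 0) (at_right 0)"
    unfolding m_def by (intro tendsto_intros mu_log_tendsto a T0)
  moreover have "\<forall>\<^sub>F y in at_right 0. y \<in> {0<..<1::real}"
    by (rule eventually_at_right_real) simp
  then have "\<forall>\<^sub>F y in at_right 0. (m y + ln y / 2) - C + \<kappa> * T y = (1 - \<kappa>) / 2 * ln y"
  proof eventually_elim
    case (elim y)
    then have "C = m y + \<kappa> * (ln y / 2 + T y)" using C[of y] by simp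
    then show ?case by (simp add: field_simps)
  qed
  ultimately have lim: "((\<lambda>y. (1 - \<kappa>) / 2 * ln y) \<longlongrightarrow> ramanujan_R a / 2 - C) (at_right 0)"
    using Lim_transform_eventually by force
  \<comment> \<open>Otherwise the logarithm would have a finite limit at 0.\<close>
  have \<kappa>: "\<kappa> = 1"
  proof (rule ccontr)
    assume "\<kappa> \<noteq> 1"
    then have "(ln \<longlongrightarrow> (ramanujan_R a / 2 - C) / ((1 - \<kappa>) / 2)) (at_right 0)"
      using tendsto_divide[OF lim tendsto_const, of "(1 - \<kappa>) / 2"] by simp
    then show False
      using not_tendsto_and_filterlim_at_infinity[OF _ _ filterlim_mono[OF ln_at_0 at_bot_le_at_infinity order_refl]]
      by auto
  qed
  then have "C = ramanujan_R a / 2"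
    using lim by (simp add: tendsto_const_iff)
  then have "T x = ramanujan_R a / 2 - (m x + ln x / 2)"
    using C[OF x] \<kappa> by simp
  moreover have "(\<lambda>n. c (Suc n) * x ^ Suc n) sums (T x - c 0 * x ^ 0)"
    using summable_sums[OF summ[of x]] x unfolding T_def by (subst sums_Suc_iff) auto
  ultimately show ?thesis by (simp add: c_def m_def)
qed

theorem theorem2p2:
  fixes a :: real and W b lam \<theta> :: "nat \<Rightarrow> real"
  assumes a: "0 < a" "a \<le> 1 / 2"
    and W: "\<And>n. W n = pochhammer (1 / 2) n / fact n"
    and b: "\<And>n. b n = pochhammer a n * pochhammer (1 - a) n / (fact n)\<^sup>2"
    and lam_0: "lam 0 = 1"
    and lam_rec: "\<And>n. n \<ge> 1 \<Longrightarrow> lam n = W n - (\<Sum>k<n. lam k * b (n - k))"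
    and theta: "\<And>n. n \<ge> 1 \<Longrightarrow> \<theta> n = 1 / (2 * real n) * (\<Sum>k\<le>n. lam k * lam (n - k))"
  shows "(\<forall>n. lam n > 0) \<and>
    (\<forall>r\<in>{0<..<1}.
       summable (\<lambda>n. \<theta> (Suc n) * r ^ (2 * Suc n)) \<and>
       groetzsch_mu a r + ln r = ramanujan_R a / 2 - (\<Sum>n. \<theta> (Suc n) * r ^ (2 * Suc n)))"
proof -
  have a1: "a < 1" using a by simp
  have b_eq: "b = hcoef a" by (simp add: fun_eq_iff b hcoef_def)
  have conv: "(\<Sum>k\<le>n. lam k * hcoef a (n - k)) = W n" for n
  proof (cases "n = 0")
    case False
    then have "(\<Sum>k\<le>n. lam k * hcoef a (n - k)) = (\<Sum>k<n. lam k * b (n - k)) + lam n"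
      by (simp add: b_eq lessThan_Suc_atMost[symmetric])
    then show ?thesis using lam_rec[of n] False by simp
  qed (simp add: lam_0 W)
  have Wpos: "0 < W n" for n by (simp add: W pochhammer_pos)
  have ratio: "hcoef a (Suc n) * W n < W (Suc n) * hcoef a n" for n
  proof -
    have "a * (1 - a) \<le> 1 / 4"
      using zero_le_power2[of "a - 1 / 2"] by (simp add: power2_eq_square algebra_simps)
    also have "1 / 4 < (real n + 1) / 2" by simp
    finally have "a * (1 - a) < (real n + 1) / 2" .
    then have "(n + a) * (real n + 1 - a) < (n + 1 / 2) * (real n + 1)"
      by (simp add: field_simps)
    then have "(n + a) * (real n + 1 - a) * (hcoef a n * W n) < (n + 1 / 2) * (real n + 1) * (hcoef a n * W n)"
      using hcoef_pos[OF a(1) a1] Wpos by (intro mult_strict_right_mono) auto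
    moreover have "(t + 1) * (q * (1 / 2 + t) / ((t + 1) * f)) = (t + 1 / 2) * (q / f)"
      if "t + 1 \<noteq> 0" for t q f :: real
      using that by (simp add: add.commute)
    from this[of n "pochhammer (1 / 2) n" "fact n"] have "(real n + 1) * W (Suc n) = (n + 1 / 2) * W n"
      by (simp add: W pochhammer_Suc add_ac)
    then have "(n + 1 / 2) * (real n + 1) * (hcoef a n * W n) = (real n + 1)\<^sup>2 * (W (Suc n) * hcoef a n)"
      by algebra
    moreover have "(n + a) * (real n + 1 - a) * (hcoef a n * W n) = (real n + 1)\<^sup>2 * (hcoef a (Suc n) * W n)"
      using hcoef_Suc[of n a] by algebra
    ultimately show ?thesis by simp
  qed
  have lam_pos: "0 < lam n" for n
    by (rule convolution_quotient_pos[of "hcoef a" W])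
      (use hcoef_pos[OF a(1) a1] Wpos hcoef_log_convex[OF a(1) a1] ratio conv in auto)
  have W1: "W n \<le> 1" for n using pochhammer_le_fact[of "1 / 2" n] by (simp add: W)
  \<comment> \<open>Positivity makes every term of the convolution at most \<open>W n\<close>; so the series of \<open>lam\<close> converges on the unit disc.\<close>
  have "lam n \<le> 1" for n
  proof -
    have "lam n * hcoef a (n - n) \<le> (\<Sum>k\<le>n. lam k * hcoef a (n - k))"
      using lam_pos hcoef_pos[OF a(1) a1]
      by (intro member_le_sum) (auto intro!: mult_nonneg_nonneg less_imp_le)
    then show ?thesis using W1[of n] conv[of n] by simp
  qed
  then have lam_abs: "\<bar>lam n\<bar> \<le> 1" for n using lam_pos[of n] by simp
  define p where "p n = (\<Sum>k\<le>n. lam k * lam (n - k))" for n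
  have p: "(\<lambda>n. p n * x ^ n) sums (1 / ((1 - x) * (hypF a x)\<^sup>2))" if x: "0 < x" "x < 1" for x
  proof -
    define L where "L = (\<Sum>n. lam n * x ^ n)"
    have s: "summable (\<lambda>n. norm (lam n * x ^ n))"
      using x lam_abs by (intro summable_bounded_powser) auto
    have coeff: "(\<Sum>k\<le>n. (lam k * x ^ k) * (g (n - k) * x ^ (n - k))) = (\<Sum>k\<le>n. lam k * g (n - k)) * x ^ n"
      for g :: "nat \<Rightarrow> real" and n
      unfolding sum_distrib_right
    proof (rule sum.cong[OF refl])
      fix k assume "k \<in> {..n}"
      then have "x ^ n = x ^ k * x ^ (n - k)" by (simp flip: power_add)
      then show "(lam k * x ^ k) * (g (n - k) * x ^ (n - k)) = lam k * g (n - k) * x ^ n" by simp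
    qed
    have "(\<lambda>n. \<Sum>k\<le>n. (lam k * x ^ k) * (hcoef a (n - k) * x ^ (n - k))) sums (L * hypF a x)"
      unfolding L_def hypF_def using a a1 x by (intro Cauchy_product_sums s summable_hcoef) auto
    then have "(\<lambda>n. W n * x ^ n) sums (L * hypF a x)" by (simp only: coeff conv)
    moreover have "(\<lambda>n. W n * x ^ n) sums (1 - x) powr (- (1 / 2))"
    proof -
      have "((- (1 / 2)) gchoose n) * (- x) ^ n = W n * x ^ n" for n
      proof -
        have "(- 1) ^ n * (- x) ^ n = x ^ n" by (simp flip: power_mult_distrib)
        moreover have "((- (1 / 2)) gchoose n) * (- x) ^ n = W n * ((- 1) ^ n * (- x) ^ n)"
          by (simp add: gbinomial_pochhammer W)
        ultimately show ?thesis by (simp only:)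
      qed
      then show ?thesis using gen_binomial_real[of "- x" "- (1 / 2)"] x by simp
    qed
    ultimately have LF: "L * hypF a x = (1 - x) powr (- (1 / 2))" by (rule sums_unique2)
    have "(1 - x) powr (- (1 / 2)) * (1 - x) powr (- (1 / 2)) = 1 / (1 - x)"
      using x by (simp add: powr_add[symmetric] powr_minus_divide)
    then have "L * L * (hypF a x)\<^sup>2 = 1 / (1 - x)"
      unfolding LF[symmetric] by (simp add: power2_eq_square mult_ac)
    then have LL: "L * L = 1 / ((1 - x) * (hypF a x)\<^sup>2)"
      using hypF_pos[OF a(1) a1, of x] x by (simp add: field_simps)
    have "(\<lambda>n. \<Sum>k\<le>n. (lam k * x ^ k) * (lam (n - k) * x ^ (n - k))) sums (L * L)"
      unfolding L_def by (intro Cauchy_product_sums s)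
    then show ?thesis by (simp only: coeff LL p_def)
  qed
  have p0: "p 0 = 1" by (simp add: p_def lam_0)
  show ?thesis
  proof (intro conjI allI ballI lam_pos)
    fix r :: real assume r: "r \<in> {0<..<1}"
    have r2: "0 < r\<^sup>2" "r\<^sup>2 < 1" using r by (auto simp: power_less_one_iff)
    have "p (Suc n) / (2 * real (Suc n)) * (r\<^sup>2) ^ Suc n = \<theta> (Suc n) * r ^ (2 * Suc n)" for n
      unfolding power_mult by (simp add: theta p_def)
    moreover have "ln (r\<^sup>2) / 2 = ln r" using r by (simp add: ln_realpow)
    ultimately have "(\<lambda>n. \<theta> (Suc n) * r ^ (2 * Suc n)) sums (ramanujan_R a / 2 - (groetzsch_mu a r + ln r))"
      using mu_log_series[OF a(1) a1 p0 p r2]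
      unfolding groetzsch_mu_def hyp2F1_eq_hypF by simp
    then show "summable (\<lambda>n. \<theta> (Suc n) * r ^ (2 * Suc n))"
      "groetzsch_mu a r + ln r = ramanujan_R a / 2 - (\<Sum>n. \<theta> (Suc n) * r ^ (2 * Suc n))"
      by (auto simp: sums_iff)
  qed
qed

end
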